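(* Let $(x(t),y(t),z(t))$ be an S-torus knot with parameters $R,r,a,p,q$. Then the following assertions are valid for all $t\in\mathbb{R}$. 1. If $a\ge r$, then $$0\le\Big[R-\sqrt{x^2(t)+y^2(t)}\Big]^2+z^2(t)-r^2\le a^2-r^2 .$$ 2. If $a\le r$, then $$a^2-r^2\le\Big[R-\sqrt{x^2(t)+y^2(t)}\Big]^2+z^2(t)-r^2\le 0 .$$
   Context: Let $p,q$ be positive integers and let $R>r>0$, $a>0$ be real. The S-torus knot with these parameters is the curve in $\mathbb{R}^3$ given by $$x(t)=[R+r\cos(qt)]\cos(pt),\quad y(t)=[R+r\cos(qt)]\sin(pt),\quad z(t)=a\sin(qt).$$ *)

theory Defs
  imports "HOL-Analysis.Analysis"
begin

text \<open>The constraints \<open>0 < r < R\<close>, \<open>0 < a\<close>, \<open>0 < p\<close>, \<open>0 < q\<close> on the parameters are not built in;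
  they have to be assumed where the curve is used. Coprimality of \<open>p\<close> and \<open>q\<close> is not required.\<close>

definition S_torus_knot :: "real \<Rightarrow> real \<Rightarrow> real \<Rightarrow> nat \<Rightarrow> nat \<Rightarrow> real \<Rightarrow> real ^ 3" where
  "S_torus_knot R r a p q t = vector
     [(R + r * cos (real q * t)) * cos (real p * t),
      (R + r * cos (real q * t)) * sin (real p * t),
      a * sin (real q * t)]"

end

theory Submission
  imports Defs
begin

text \<open>At parameter \<open>t\<close> the curve has distance \<open>R + r cos(qt)\<close> from the \<open>z\<close>-axis; no absolute
  value enters because \<open>r < R\<close> makes this quantity positive (as \<open>r > 0\<close>). Hence
  \<open>R - sqrt (x\<^sup>2 + y\<^sup>2) = - r cos(qt)\<close>, and the quantity to be bounded becomes
  \<open>r\<^sup>2 cos\<^sup>2(qt) + a\<^sup>2 sin\<^sup>2(qt) - r\<^sup>2 = (a\<^sup>2 - r\<^sup>2) sin\<^sup>2(qt)\<close>.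
  Since \<open>0 \<le> sin\<^sup>2(qt) \<le> 1\<close>, it lies between \<open>0\<close> and \<open>a\<^sup>2 - r\<^sup>2\<close>; the sign of
  \<open>a\<^sup>2 - r\<^sup>2\<close> decides which of the two is the upper bound.\<close>

text \<open>The bound \<open>\<bar>r\<bar> \<le> R\<close> keeps the cross-section on one side of the axis, so that the square
  root undoes the square. The angles \<open>u\<close> and \<open>v\<close> are independent: the identity belongs to
  the whole torus with elliptical cross-section that carries the curve.\<close>

lemma torus_defect_eq:
  fixes R r a u v :: real
  assumes "\<bar>r\<bar> \<le> R"
  shows "(R - sqrt (((R + r * cos v) * cos u)\<^sup>2 + ((R + r * cos v) * sin u)\<^sup>2))\<^sup>2
           + (a * sin v)\<^sup>2 - r\<^sup>2 = (a\<^sup>2 - r\<^sup>2) * (sin v)\<^sup>2"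
proof -
  have "\<bar>r * cos v\<bar> \<le> \<bar>r\<bar>"
    by (simp add: abs_mult mult_left_le)
  with assms have nonneg: "0 \<le> R + r * cos v"
    by linarith
  have "((R + r * cos v) * cos u)\<^sup>2 + ((R + r * cos v) * sin u)\<^sup>2
          = (R + r * cos v)\<^sup>2 * ((cos u)\<^sup>2 + (sin u)\<^sup>2)"
    by (simp only: power_mult_distrib distrib_left)
  then have "sqrt (((R + r * cos v) * cos u)\<^sup>2 + ((R + r * cos v) * sin u)\<^sup>2) = R + r * cos v"
    using nonneg by simp
  then show ?thesis
    by (simp add: power_mult_distrib cos_squared_eq algebra_simps)
qed

theorem proposition13p5:
  fixes R r a :: real and p q :: nat and x y z :: "real \<Rightarrow> real"
  assumes "0 < r" and "r < R" and "0 < a" and "0 < p" and "0 < q"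
    and "(\<lambda>t. vector [x t, y t, z t]) = S_torus_knot R r a p q"
  shows "(r \<le> a \<longrightarrow>
            (\<forall>t. 0 \<le> (R - sqrt ((x t)\<^sup>2 + (y t)\<^sup>2))\<^sup>2 + (z t)\<^sup>2 - r\<^sup>2 \<and>
                 (R - sqrt ((x t)\<^sup>2 + (y t)\<^sup>2))\<^sup>2 + (z t)\<^sup>2 - r\<^sup>2 \<le> a\<^sup>2 - r\<^sup>2)) \<and>
         (a \<le> r \<longrightarrow>
            (\<forall>t. a\<^sup>2 - r\<^sup>2 \<le> (R - sqrt ((x t)\<^sup>2 + (y t)\<^sup>2))\<^sup>2 + (z t)\<^sup>2 - r\<^sup>2 \<and>
                 (R - sqrt ((x t)\<^sup>2 + (y t)\<^sup>2))\<^sup>2 + (z t)\<^sup>2 - r\<^sup>2 \<le> 0))"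
proof -
  have defect: "(R - sqrt ((x t)\<^sup>2 + (y t)\<^sup>2))\<^sup>2 + (z t)\<^sup>2 - r\<^sup>2 = (a\<^sup>2 - r\<^sup>2) * (sin (real q * t))\<^sup>2"
    for t
  proof -
    have curve: "(vector [x t, y t, z t] :: real ^ 3) = S_torus_knot R r a p q t"
      using assms(6) by (rule fun_cong)
    have "x t = (R + r * cos (real q * t)) * cos (real p * t)"
      using arg_cong[OF curve, of "\<lambda>w. w $ 1"] by (simp add: S_torus_knot_def)
    moreover have "y t = (R + r * cos (real q * t)) * sin (real p * t)"
      using arg_cong[OF curve, of "\<lambda>w. w $ 2"] by (simp add: S_torus_knot_def)
    moreover have "z t = a * sin (real q * t)"
      using arg_cong[OF curve, of "\<lambda>w. w $ 3"] by (simp add: S_torus_knot_def)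
    ultimately show ?thesis
      using assms(1,2) torus_defect_eq[of r R "real q * t" "real p * t" a] by simp
  qed
  have sin2_le: "(sin (real q * t))\<^sup>2 \<le> 1" for t
    by (simp add: abs_square_le_1)
  show ?thesis
  proof (intro conjI impI allI)
    fix t
    assume "r \<le> a"
    then have sign: "0 \<le> a\<^sup>2 - r\<^sup>2"
      using assms(1) by (simp add: power_mono)
    show "0 \<le> (R - sqrt ((x t)\<^sup>2 + (y t)\<^sup>2))\<^sup>2 + (z t)\<^sup>2 - r\<^sup>2"
      unfolding defect using sign by (rule mult_nonneg_nonneg) simp
    show "(R - sqrt ((x t)\<^sup>2 + (y t)\<^sup>2))\<^sup>2 + (z t)\<^sup>2 - r\<^sup>2 \<le> a\<^sup>2 - r\<^sup>2"
      unfolding defect using mult_left_mono[OF sin2_le sign] by simp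
  next
    fix t
    assume "a \<le> r"
    then have sign: "a\<^sup>2 - r\<^sup>2 \<le> 0"
      using assms(3) by (simp add: power_mono)
    show "a\<^sup>2 - r\<^sup>2 \<le> (R - sqrt ((x t)\<^sup>2 + (y t)\<^sup>2))\<^sup>2 + (z t)\<^sup>2 - r\<^sup>2"
      unfolding defect using mult_left_mono_neg[OF sin2_le sign] by simp
    show "(R - sqrt ((x t)\<^sup>2 + (y t)\<^sup>2))\<^sup>2 + (z t)\<^sup>2 - r\<^sup>2 \<le> 0"
      unfolding defect using sign by (rule mult_nonpos_nonneg) simp
  qed
qed

end
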